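(* Let $I\subseteq\mathbb{R}$ be an interval with interior $I^{\circ}$, and let $f:I\to\mathbb{R}$ be twice differentiable on $I^{\circ}$ with $f''\in L[a,b]$, where $a,b\in I$ and $a<b$. Then for all $x\in[a,b]$, $\lambda\in[0,1]$ and $\alpha>0$, $$I_f(x,\lambda,\alpha,a,b)=\frac{(x-a)^{\alpha+2}}{(\alpha+1)(b-a)}\int_0^1t\big((\alpha+1)\lambda-t^{\alpha}\big)f''\big(tx+(1-t)a\big)\,dt+\frac{(b-x)^{\alpha+2}}{(\alpha+1)(b-a)}\int_0^1t\big((\alpha+1)\lambda-t^{\alpha}\big)f''\big(tx+(1-t)b\big)\,dt.$$
   Context: For $a,b\in I$ with $a<b$, $x\in[a,b]$, $\lambda\in[0,1]$, $\alpha>0$, define $$I_f(x,\lambda,\alpha,a,b)=(1-\lambda)\left[\frac{(x-a)^{\alpha}+(b-x)^{\alpha}}{b-a}\right]f(x)+\lambda\left[\frac{(x-a)^{\alpha}f(a)+(b-x)^{\alpha}f(b)}{b-a}\right]+\left(\frac1{\alpha+1}-\lambda\right)\left[\frac{(b-x)^{\alpha+1}-(x-a)^{\alpha+1}}{b-a}\right]f'(x)-\frac{\Gamma(\alpha+1)}{b-a}\left[J^{\alpha}_{x^-}f(a)+J^{\alpha}_{x^+}f(b)\right],$$ where $\Gamma$ is the Gamma function and the Riemann–Liouville fractional integrals are $$J^{\alpha}_{x^-}f(a)=\frac1{\Gamma(\alpha)}\int_a^x(t-a)^{\alpha-1}f(t)\,dt,\qquad J^{\alpha}_{x^+}f(b)=\frac1{\Gamma(\alpha)}\int_x^b(b-t)^{\alpha-1}f(t)\,dt$$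 (equal to $0$ when $x=a$, respectively $x=b$).
   Formalization: Continuity of f on [a,b] is added; it matters only if a or b is an endpoint of I. Without it the claim fails: I=[0,1], a=0, b=1, f=0 on (0,1], f(0)=1, x=1/2, λ=α=1 gives I_f=1/2 but right side 0. At endpoints of I, f'(x) is one-sided. *)

theory Defs
  imports "HOL-Analysis.Analysis"
begin

text \<open>Riemann--Liouville integrals: \<^term>\<open>RL_minus \<alpha> x f s\<close> is $J^\alpha_{x^-} f(s)$ for
  \<^prop>\<open>s \<le> x\<close>, and \<^term>\<open>RL_plus \<alpha> x f s\<close> is $J^\alpha_{x^+} f(s)$ for \<^prop>\<open>x \<le> s\<close>.
  Both vanish at \<^prop>\<open>s = x\<close>, where the domain of integration is a single point.\<close>

definition RL_minus :: "real \<Rightarrow> real \<Rightarrow> (real \<Rightarrow> real) \<Rightarrow> real \<Rightarrow> real" where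
  "RL_minus \<alpha> x f s =
     1 / Gamma \<alpha> * (LINT t:{s..x}|lebesgue. (t - s) powr (\<alpha> - 1) * f t)"

definition RL_plus :: "real \<Rightarrow> real \<Rightarrow> (real \<Rightarrow> real) \<Rightarrow> real \<Rightarrow> real" where
  "RL_plus \<alpha> x f s =
     1 / Gamma \<alpha> * (LINT t:{x..s}|lebesgue. (s - t) powr (\<alpha> - 1) * f t)"

text \<open>A function $f : I \to \mathbb{R}$ is a total function whose values outside \<^term>\<open>I\<close> are
  irrelevant. Hence $f'(x)$ is taken within \<^term>\<open>I\<close>: it is the ordinary derivative at interior
  points and the one-sided derivative if \<^term>\<open>x\<close> is an endpoint of \<^term>\<open>I\<close>.\<close>

definition I_fun ::
  "real set \<Rightarrow> (real \<Rightarrow> real) \<Rightarrow> real \<Rightarrow> real \<Rightarrow> real \<Rightarrow> real \<Rightarrow> real \<Rightarrow> real" where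
  "I_fun I f x lam \<alpha> a b =
     (1 - lam) * (((x - a) powr \<alpha> + (b - x) powr \<alpha>) / (b - a)) * f x
   + lam * (((x - a) powr \<alpha> * f a + (b - x) powr \<alpha> * f b) / (b - a))
   + (1 / (\<alpha> + 1) - lam) * (((b - x) powr (\<alpha> + 1) - (x - a) powr (\<alpha> + 1)) / (b - a))
       * vector_derivative f (at x within I)
   - Gamma (\<alpha> + 1) / (b - a) * (RL_minus \<alpha> x f a + RL_plus \<alpha> x f b)"

end

theory Submission
  imports Defs
begin

text \<open>With \<open>u = x - a\<close> and \<open>\<phi> t = f (a + t)\<close>, put
  \<open>K t = \<lambda> u\<^sup>\<alpha> t - t\<^sup>\<alpha>\<^sup>+\<^sup>1 / (\<alpha> + 1)\<close>. After rescaling to \<open>[0, u]\<close>, the first integral on the right is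
  the integral of \<open>K \<phi>''\<close>, and \<open>(K \<phi>' - K' \<phi>)' = K \<phi>'' - K'' \<phi>\<close> with \<open>K'' t = - \<alpha> t\<^sup>\<alpha>\<^sup>-\<^sup>1\<close>
  yields the left half of \<open>I_f\<close>. The right half is the same identity for \<open>\<phi> t = f (b - t)\<close>.
  Since \<open>f''\<close> is integrable, \<open>f'\<close> extends continuously to \<open>[a, b]\<close>, and the extension is the
  derivative of \<open>f\<close> within \<open>[a, b]\<close>, also at the endpoints.\<close>

section \<open>Affine substitution and products with continuous factors in Lebesgue
  integrals\<close>

lemma set_lebesgue_integral_real_affine:
  fixes f :: "real \<Rightarrow> real"
  assumes "c \<noteq> 0"
  shows "(LINT x:A|lebesgue. f x) = \<bar>c\<bar> * (LINT x:{x. t + c * x \<in> A}|lebesgue. f (t + c * x))"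
proof -
  have "indicator {x. t + c * x \<in> A} x = (indicator A (t + c * x) :: real)" for x
    by (simp add: indicator_def)
  then show ?thesis
    unfolding set_lebesgue_integral_def
    by (subst lebesgue_integral_real_affine[OF assms, of _ t]) simp
qed

lemma set_integrable_lebesgue_real_affine:
  fixes f :: "real \<Rightarrow> real"
  assumes "set_integrable lebesgue A f" and "c \<noteq> 0"
  shows "set_integrable lebesgue {x. t + c * x \<in> A} (\<lambda>x. f (t + c * x))"
proof -
  have "indicator {x. t + c * x \<in> A} x = (indicator A (t + c * x) :: real)" for x
    by (simp add: indicator_def)
  then show ?thesis
    using lebesgue_integrable_real_affine[OF assms(1)[unfolded set_integrable_def] assms(2), of t]
    unfolding set_integrable_def by simp
qed

lemma absolutely_integrable_continuous_mult:
  fixes k h :: "real \<Rightarrow> real"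
  assumes "continuous_on {a..b} k" and "h absolutely_integrable_on {a..b}"
  shows "(\<lambda>t. k t * h t) absolutely_integrable_on {a..b}"
proof (rule absolutely_integrable_bounded_measurable_product_real)
  show "k \<in> borel_measurable (lebesgue_on {a..b})"
    using assms(1) by (simp add: continuous_imp_measurable_on_sets_lebesgue)
  show "bounded (k ` {a..b})"
    using assms(1) by (simp add: compact_continuous_image compact_imp_bounded)
qed (use assms in auto)

text \<open>On compact subintervals of the open interval the increments of \<open>f'\<close> are
  integrals of \<open>h\<close>. The indefinite integral of \<open>h\<close> is continuous up to
  \<open>a\<close> and \<open>b\<close>, so it supplies the boundary values that \<open>f'\<close>
  itself need not have.\<close>

lemma obtain_derivative_within_closed_interval:
  fixes f h :: "real \<Rightarrow> real"
  assumes "a < b" and contf: "continuous_on {a..b} f"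
    and f': "\<And>x. x \<in> {a<..<b} \<Longrightarrow> (f has_real_derivative f' x) (at x)"
    and f'': "\<And>x. x \<in> {a<..<b} \<Longrightarrow> (f' has_real_derivative h x) (at x)"
    and h: "h integrable_on {a..b}"
  obtains g where "continuous_on {a..b} g"
    and "\<And>x. x \<in> {a..b} \<Longrightarrow> (f has_real_derivative g x) (at x within {a..b})"
    and "\<And>x. x \<in> {a<..<b} \<Longrightarrow> (f has_real_derivative g x) (at x)"
    and "\<And>x. x \<in> {a<..<b} \<Longrightarrow> (g has_real_derivative h x) (at x)"
proof -
  \<comment> \<open>Nothing is known about \<open>f'\<close> at \<open>a\<close> or
    \<open>b\<close>, so the primitive of \<open>h\<close> is anchored at an interior point; the
    midpoint is an arbitrary choice.\<close>
  define c where "c = (a + b) / 2"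
  have c: "a < c" "c < b" using \<open>a < b\<close> by (auto simp: c_def)
  define g where "g = (\<lambda>y. f' c + (integral {a..y} h - integral {a..c} h))"
  have contg: "continuous_on {a..b} g"
    unfolding g_def by (intro continuous_intros indefinite_integral_continuous_1 h)
  have diff: "f' y - f' x = integral {a..y} h - integral {a..x} h"
    if "a < x" "x \<le> y" "y < b" for x y
  proof -
    have "(h has_integral f' y - f' x) {x..y}"
    proof (rule fundamental_theorem_of_calculus)
      fix z assume "z \<in> {x..y}"
      then have "(f' has_real_derivative h z) (at z)" using that f'' by auto
      then show "(f' has_vector_derivative h z) (at z within {x..y})"
        by (simp add: has_real_derivative_iff_has_vector_derivative has_vector_derivative_at_within)
    qed (use that in auto)
    then have "integral {x..y} h = f' y - f' x" by (rule integral_unique)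
    moreover have "h integrable_on {a..y}"
      using h by (rule integrable_on_subinterval) (use that in auto)
    then have "integral {a..x} h + integral {x..y} h = integral {a..y} h"
      using that by (intro Henstock_Kurzweil_Integration.integral_combine) auto
    ultimately show ?thesis by simp
  qed
  have g_eq: "g y = f' y" if "y \<in> {a<..<b}" for y
    using diff[of c y] diff[of y c] that c by (cases "c \<le> y") (auto simp: g_def)
  \<comment> \<open>\<open>f\<close> is first recovered as a primitive of \<open>g\<close>, which
    takes derivatives only in the open interval. Continuity of \<open>g\<close> then makes this
    primitive differentiable at the endpoints as well.\<close>
  have "(f has_vector_derivative g x) (at x within {a..b})" if x: "x \<in> {a..b}" for x
  proof (rule has_vector_derivative_transform[where f = "\<lambda>y. f a + integral {a..y} g"])
    show "f y = f a + integral {a..y} g" if "y \<in> {a..b}" for y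
    proof -
      have "(g has_integral f y - f a) {a..y}"
        using contf f' that by (intro fundamental_theorem_of_calculus_interior)
          (auto intro: continuous_on_subset
            simp: g_eq simp flip: has_real_derivative_iff_has_vector_derivative)
      then show ?thesis by (simp add: integral_unique)
    qed
    have "((\<lambda>y. f a + integral {a..y} g) has_vector_derivative 0 + g x) (at x within {a..b})"
      by (intro has_vector_derivative_add has_vector_derivative_const
          integral_has_vector_derivative contg x)
    then show "((\<lambda>y. f a + integral {a..y} g) has_vector_derivative g x) (at x within {a..b})"
      by simp
  qed (use x in auto)
  moreover have "(g has_real_derivative h x) (at x)" if "x \<in> {a<..<b}" for x
    using f''[OF that]
    by (rule has_field_derivative_transform_within_open[where S = "{a<..<b}"])
      (use that g_eq in auto)
  ultimately show thesis
    using that[of g] contg f' g_eq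
    by (simp add: has_real_derivative_iff_has_vector_derivative)
qed

text \<open>The variable is the distance from an endpoint of the original interval, so one statement
  serves both halves. Allowing \<open>u = 0\<close> covers \<open>x = a\<close> and
  \<open>x = b\<close>.\<close>

lemma fractional_integral_by_parts:
  fixes \<phi> \<gamma> h :: "real \<Rightarrow> real"
  assumes u: "0 \<le> u" and \<alpha>: "0 < \<alpha>"
    and cont: "continuous_on {0..u} \<phi>" "continuous_on {0..u} \<gamma>"
    and \<phi>': "\<And>t. t \<in> {0<..<u} \<Longrightarrow> (\<phi> has_real_derivative \<gamma> t) (at t)"
    and \<gamma>': "\<And>t. t \<in> {0<..<u} \<Longrightarrow> (\<gamma> has_real_derivative h t) (at t)"
    and h: "h absolutely_integrable_on {0..u}"
  shows "u powr (\<alpha> + 2) / (\<alpha> + 1)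
        * (LINT t:{0..1}|lebesgue. t * ((\<alpha> + 1) * lam - t powr \<alpha>) * h (u * t))
    = (lam - 1 / (\<alpha> + 1)) * u powr (\<alpha> + 1) * \<gamma> u + (1 - lam) * u powr \<alpha> * \<phi> u
      + lam * u powr \<alpha> * \<phi> 0 - \<alpha> * (LINT t:{0..u}|lebesgue. t powr (\<alpha> - 1) * \<phi> t)"
proof (cases "u = 0")
  case True
  \<comment> \<open>For \<open>u = 0\<close> all powers of \<open>u\<close> vanish, because
    \<open>0 powr z = 0\<close>. What remains is an integral over a single point, which is a null
    set.\<close>
  have "AE t in lebesgue. t \<notin> {0::real}"
    by (rule AE_not_in) (simp add: null_sets_def)
  then have "(LINT t:{0}|lebesgue. q t) = 0" for q :: "real \<Rightarrow> real"
    unfolding set_lebesgue_integral_def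
    by (intro integral_eq_zero_AE) (auto elim!: eventually_mono)
  then show ?thesis using True \<alpha> by simp
next
  case False
  then have u: "0 < u" using u by simp
  define K where "K = (\<lambda>t. lam * u powr \<alpha> * t - t powr (\<alpha> + 1) / (\<alpha> + 1))"
  define K' where "K' = (\<lambda>t. lam * u powr \<alpha> - t powr \<alpha>)"
  have contK: "continuous_on {0..u} K"
    unfolding K_def using \<alpha> by (auto intro!: continuous_intros continuous_on_powr')
  have contK': "continuous_on {0..u} K'"
    unfolding K'_def using \<alpha> by (auto intro!: continuous_intros continuous_on_powr')
  have Kh: "(\<lambda>t. K t * h t) absolutely_integrable_on {0..u}"
    by (rule absolutely_integrable_continuous_mult[OF contK h])
  \<comment> \<open>For \<alpha> < 1 this factor is unbounded near 0, but it is integrable since its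
    exponent exceeds -1. Here the continuous factor is \<open>\<phi>\<close>.\<close>
  have "(\<lambda>t. t powr (\<alpha> - 1)) absolutely_integrable_on {0..u}"
    using has_integral_powr_from_0[of "\<alpha> - 1" u] \<alpha> u
    by (intro nonnegative_absolutely_integrable_1) auto
  from absolutely_integrable_continuous_mult[OF cont(1) this]
  have p: "(\<lambda>t. t powr (\<alpha> - 1) * \<phi> t) absolutely_integrable_on {0..u}"
    by (simp add: mult.commute)
  \<comment> \<open>The primitive is differentiated only in the open interval, which avoids the
    possible singularity of \<open>K''\<close> at 0; at the endpoints continuity suffices.
    \<open>Kh\<close> and \<open>p\<close> then allow the integral to be split and read as Lebesgue
    integrals.\<close>
  have "((\<lambda>t. K t * h t + \<alpha> * (t powr (\<alpha> - 1) * \<phi> t)) has_integral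
      (K u * \<gamma> u - K' u * \<phi> u) - (K 0 * \<gamma> 0 - K' 0 * \<phi> 0)) {0..u}"
  proof (rule fundamental_theorem_of_calculus_interior)
    show "continuous_on {0..u} (\<lambda>t. K t * \<gamma> t - K' t * \<phi> t)"
      by (intro continuous_intros contK contK' cont)
    fix t assume t: "t \<in> {0<..<u}"
    have "(K has_real_derivative K' t) (at t)"
      unfolding K_def K'_def using t \<alpha> by (auto intro!: derivative_eq_intros)
    moreover have "(K' has_real_derivative - (\<alpha> * t powr (\<alpha> - 1))) (at t)"
      unfolding K'_def using t by (auto intro!: derivative_eq_intros)
    ultimately have "((\<lambda>t. K t * \<gamma> t - K' t * \<phi> t) has_real_derivative
        K t * h t + \<alpha> * (t powr (\<alpha> - 1) * \<phi> t)) (at t)"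
      by (auto intro!: derivative_eq_intros \<phi>'[OF t] \<gamma>'[OF t])
    then show "((\<lambda>t. K t * \<gamma> t - K' t * \<phi> t) has_vector_derivative
        K t * h t + \<alpha> * (t powr (\<alpha> - 1) * \<phi> t)) (at t)"
      by (simp add: has_real_derivative_iff_has_vector_derivative)
  qed (use u in simp)
  then have "integral {0..u} (\<lambda>t. K t * h t + \<alpha> * (t powr (\<alpha> - 1) * \<phi> t))
      = (K u * \<gamma> u - K' u * \<phi> u) - (K 0 * \<gamma> 0 - K' 0 * \<phi> 0)"
    by (rule integral_unique)
  moreover have "integral {0..u} (\<lambda>t. K t * h t + \<alpha> * (t powr (\<alpha> - 1) * \<phi> t))
      = integral {0..u} (\<lambda>t. K t * h t) + \<alpha> * integral {0..u} (\<lambda>t. t powr (\<alpha> - 1) * \<phi> t)"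
    using Kh p
    by (subst Henstock_Kurzweil_Integration.integral_add)
      (auto intro!: integrable_on_mult_right dest: set_lebesgue_integral_eq_integral(1))
  ultimately have parts: "(LINT t:{0..u}|lebesgue. K t * h t)
      = (K u * \<gamma> u - K' u * \<phi> u) - (K 0 * \<gamma> 0 - K' 0 * \<phi> 0)
        - \<alpha> * (LINT t:{0..u}|lebesgue. t powr (\<alpha> - 1) * \<phi> t)"
    by (simp add: set_lebesgue_integral_eq_integral(2)[OF Kh]
        set_lebesgue_integral_eq_integral(2)[OF p])
  \<comment> \<open>The coefficient \<open>u powr \<alpha>\<close> in \<open>K\<close> makes both
    terms of \<open>K (u * t)\<close> scale like \<open>u powr (\<alpha> + 1)\<close>; the Jacobian
    contributes one more \<open>u\<close>.\<close>
  have K_scale: "u * (K (u * t) * h (u * t))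
      = u powr (\<alpha> + 2) / (\<alpha> + 1) * (t * ((\<alpha> + 1) * lam - t powr \<alpha>) * h (u * t))"
    if "t \<in> {0..1}" for t
    using that u \<alpha> by (simp add: K_def powr_mult powr_add powr_numeral field_simps power2_eq_square)
  have "(LINT t:{0..u}|lebesgue. K t * h t) = (LINT t:{0..1}|lebesgue. u * (K (u * t) * h (u * t)))"
  proof -
    have "{x. u * x \<in> {0..u}} = {0..1}" using u by (auto simp: zero_le_mult_iff)
    then show ?thesis
      using set_lebesgue_integral_real_affine[of u "{0..u}" "\<lambda>t. K t * h t" 0] u by simp
  qed
  also have "\<dots> = (LINT t:{0..1}|lebesgue. u powr (\<alpha> + 2) / (\<alpha> + 1)
      * (t * ((\<alpha> + 1) * lam - t powr \<alpha>) * h (u * t)))"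
    by (rule set_lebesgue_integral_cong) (use K_scale in auto)
  finally have "u powr (\<alpha> + 2) / (\<alpha> + 1)
        * (LINT t:{0..1}|lebesgue. t * ((\<alpha> + 1) * lam - t powr \<alpha>) * h (u * t))
      = (LINT t:{0..u}|lebesgue. K t * h t)"
    by simp
  also note parts
  \<comment> \<open>This removes \<open>\<gamma> 0\<close>, so no first derivative at
    \<open>a\<close> or \<open>b\<close> enters the formula.\<close>
  also have "K 0 = 0" using \<alpha> by (simp add: K_def)
  also have "K' 0 = lam * u powr \<alpha>" using \<alpha> by (simp add: K'_def)
  also have "K u = (lam - 1 / (\<alpha> + 1)) * u powr (\<alpha> + 1)"
    using u by (simp add: K_def powr_add algebra_simps)
  finally show ?thesis by (simp add: K'_def algebra_simps)
qed

text \<open>If \<open>a\<close> is an endpoint of \<open>I\<close>, differentiability in the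
  interior does not control \<open>f a\<close>. For \<open>a < x\<close>, changing
  \<open>f a\<close> alone alters the \<open>lam\<close> term on the left but none of the integrals;
  continuity on \<open>{a..b}\<close> excludes such jumps, and likewise at \<open>b\<close>.\<close>

theorem lemma1:
  fixes I :: "real set" and f :: "real \<Rightarrow> real" and a b :: real
  assumes "is_interval I"
    and "a \<in> I" and "b \<in> I" and "a < b"
    and "\<forall>y\<in>interior I. f differentiable (at y)"
    and "\<forall>y\<in>interior I. deriv f differentiable (at y)"
    and "continuous_on {a..b} f"
    and "deriv (deriv f) absolutely_integrable_on {a..b}"
  shows "\<forall>x\<in>{a..b}. \<forall>lam\<in>{0..1}. \<forall>\<alpha>>0.
    I_fun I f x lam \<alpha> a b =
      (x - a) powr (\<alpha> + 2) / ((\<alpha> + 1) * (b - a))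
        * (LINT t:{0..1}|lebesgue.
             t * ((\<alpha> + 1) * lam - t powr \<alpha>) * deriv (deriv f) (t * x + (1 - t) * a))
    + (b - x) powr (\<alpha> + 2) / ((\<alpha> + 1) * (b - a))
        * (LINT t:{0..1}|lebesgue.
             t * ((\<alpha> + 1) * lam - t powr \<alpha>) * deriv (deriv f) (t * x + (1 - t) * b))"
proof (intro ballI allI impI)
  fix x lam \<alpha> :: real
  assume x: "x \<in> {a..b}" and \<alpha>: "0 < \<alpha>"

  \<comment> \<open>The first derivative on the closed interval and its value at \<open>x\<close>
    within \<open>I\<close>\<close>
  define h where "h = deriv (deriv f)"
  have h: "h absolutely_integrable_on {a..b}" using assms(8) by (simp add: h_def)
  have sub: "{a..b} \<subseteq> I"
    using assms(1-3) by (meson atLeastAtMost_iff mem_is_interval_1_I subsetI)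
  then have int: "{a<..<b} \<subseteq> interior I"
    by (intro interior_maximal) auto
  have DI: "(f has_real_derivative deriv f y) (at y)" if "y \<in> interior I" for y
    using assms(5) that by (simp add: DERIV_deriv_iff_real_differentiable)
  have "(deriv f has_real_derivative h y) (at y)" if "y \<in> {a<..<b}" for y
    using assms(6) that int by (auto simp: DERIV_deriv_iff_real_differentiable h_def)
  then obtain g where contg: "continuous_on {a..b} g"
    and fg: "\<And>y. y \<in> {a..b} \<Longrightarrow> (f has_real_derivative g y) (at y within {a..b})"
    and fg': "\<And>y. y \<in> {a<..<b} \<Longrightarrow> (f has_real_derivative g y) (at y)"
    and gh: "\<And>y. y \<in> {a<..<b} \<Longrightarrow> (g has_real_derivative h y) (at y)"
    using obtain_derivative_within_closed_interval[OF assms(4,7), of "deriv f" h] DI int h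
      set_lebesgue_integral_eq_integral(1) by blast
  \<comment> \<open>If \<open>x\<close> is not interior to \<open>I\<close>, it is an endpoint of
    both \<open>I\<close> and \<open>{a..b}\<close>, and near it the two sets coincide.\<close>
  have "\<exists>D. (f has_vector_derivative D) (at x within I)"
  proof (cases "x \<in> interior I")
    case True
    then show ?thesis
      using DI[of x]
      by (auto simp: has_real_derivative_iff_has_vector_derivative
          intro: has_vector_derivative_at_within)
  next
    case False
    have Ioo: "{p<..<q} \<subseteq> interior I" if "p \<in> I" "q \<in> I" for p q
      using assms(1) that
      by (intro interior_maximal subsetI) (auto intro: mem_is_interval_1_I[of I p q])
    from False have "x = a \<or> x = b" using x int by force
    then have "at x within I = at x within {a..b}"
    proof
      assume "x = a"
      \<comment> \<open>A point \<open>y < a\<close> of \<open>I\<close> would put \<open>a\<close>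
        into \<open>{y<..<b}\<close>, hence into the interior.\<close>
      then have "a \<le> y" if "y \<in> I" for y
        using False Ioo[OF that assms(3)] assms(4) by force
      with sub \<open>x = a\<close> assms(4) show ?thesis
        by (intro at_within_nhd[of x "{..<b}"]) auto
    next
      assume "x = b"
      then have "y \<le> b" if "y \<in> I" for y
        using False Ioo[OF assms(2) that] assms(4) by force
      with sub \<open>x = b\<close> assms(4) show ?thesis
        by (intro at_within_nhd[of x "{a<..}"]) auto
    qed
    then show ?thesis
      using fg[OF x] by (auto simp: has_real_derivative_iff_has_vector_derivative)
  qed
  then obtain D where D: "(f has_vector_derivative D) (at x within I)" by blast
  have nontriv: "at x within {a..b} \<noteq> bot"
    using x assms(4) by (simp add: trivial_limit_within)
  have "g x = D"
    using fg[OF x] has_vector_derivative_within_subset[OF D sub]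
      vector_derivative_unique_within[OF nontriv]
    by (simp add: has_real_derivative_iff_has_vector_derivative)
  moreover have "at x within I \<noteq> bot"
    using nontriv at_le[OF sub, of x] by (auto simp: bot_unique)
  ultimately have deriv_x: "vector_derivative f (at x within I) = g x"
    using D by (simp add: vector_derivative_within)

  \<comment> \<open>The fractional integrals and the two halves of the identity, in terms of the
    distance from \<open>a\<close> or \<open>b\<close>\<close>
  have "(LINT t:{a..x}|lebesgue. (t - a) powr (\<alpha> - 1) * f t)
      = (LINT t:{0..x - a}|lebesgue. t powr (\<alpha> - 1) * f (a + t))"
  proof -
    have "{t. a + 1 * t \<in> {a..x}} = {0..x - a}" by auto
    then show ?thesis
      by (subst set_lebesgue_integral_real_affine[of 1 _ _ a]) simp_all
  qed
  moreover have "(LINT t:{x..b}|lebesgue. (b - t) powr (\<alpha> - 1) * f t)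
      = (LINT t:{0..b - x}|lebesgue. t powr (\<alpha> - 1) * f (b - t))"
  proof -
    have "{t. b + -1 * t \<in> {x..b}} = {0..b - x}" by auto
    then show ?thesis
      by (subst set_lebesgue_integral_real_affine[of "-1" _ _ b]) simp_all
  qed
  moreover have "Gamma \<alpha> \<noteq> 0"
    using Gamma_real_pos[OF \<alpha>] by simp
  moreover from this have "Gamma (\<alpha> + 1) = \<alpha> * Gamma \<alpha>"
    by (intro Gamma_plus1) (simp add: Gamma_eq_zero_iff)
  ultimately have RL: "Gamma (\<alpha> + 1) * (RL_minus \<alpha> x f a + RL_plus \<alpha> x f b)
      = \<alpha> * ((LINT t:{0..x - a}|lebesgue. t powr (\<alpha> - 1) * f (a + t))
           + (LINT t:{0..b - x}|lebesgue. t powr (\<alpha> - 1) * f (b - t)))"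
    by (simp add: RL_minus_def RL_plus_def field_simps)

  \<comment> \<open>The arguments \<open>a + (x - a)\<close> and \<open>a + 0\<close> stay
    unsimplified so that they match \<open>\<phi> u\<close> and \<open>\<phi> 0\<close> for
    \<open>\<phi> t = f (a + t)\<close>.\<close>
  have left: "(x - a) powr (\<alpha> + 2) / (\<alpha> + 1)
        * (LINT t:{0..1}|lebesgue. t * ((\<alpha> + 1) * lam - t powr \<alpha>) * h (a + (x - a) * t))
    = (lam - 1 / (\<alpha> + 1)) * (x - a) powr (\<alpha> + 1) * g (a + (x - a))
      + (1 - lam) * (x - a) powr \<alpha> * f (a + (x - a)) + lam * (x - a) powr \<alpha> * f (a + 0)
      - \<alpha> * (LINT t:{0..x - a}|lebesgue. t powr (\<alpha> - 1) * f (a + t))"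
  proof (rule fractional_integral_by_parts[where h = "\<lambda>t. h (a + t)" and \<gamma> = "\<lambda>t. g (a + t)"])
    show "continuous_on {0..x - a} (\<lambda>t. f (a + t))" "continuous_on {0..x - a} (\<lambda>t. g (a + t))"
      using x by (auto intro!: continuous_intros continuous_on_compose2[OF assms(7)]
          continuous_on_compose2[OF contg])
    have "(\<lambda>t. h (a + t)) absolutely_integrable_on {t. a + t \<in> {a..b}}"
      using set_integrable_lebesgue_real_affine[OF h, of 1 a] by simp
    then show "(\<lambda>t. h (a + t)) absolutely_integrable_on {0..x - a}"
      by (rule set_integrable_subset) (use x in auto)
    fix t assume "t \<in> {0<..<x - a}"
    then have t: "a + t \<in> {a<..<b}" using x by auto
    have shift: "((\<lambda>t. a + t) has_real_derivative 1) (at t)"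
      by (auto intro!: derivative_eq_intros)
    show "((\<lambda>t. f (a + t)) has_real_derivative g (a + t)) (at t)"
      using DERIV_chain2[OF fg'[OF t] shift] by simp
    show "((\<lambda>t. g (a + t)) has_real_derivative h (a + t)) (at t)"
      using DERIV_chain2[OF gh[OF t] shift] by simp
  qed (use x \<alpha> in auto)

  \<comment> \<open>Reflection changes the sign of the first derivative and preserves that of the
    second. This produces the difference of the two powers in the coefficient of
    \<open>g x\<close>.\<close>
  have right: "(b - x) powr (\<alpha> + 2) / (\<alpha> + 1)
        * (LINT t:{0..1}|lebesgue. t * ((\<alpha> + 1) * lam - t powr \<alpha>) * h (b - (b - x) * t))
    = (lam - 1 / (\<alpha> + 1)) * (b - x) powr (\<alpha> + 1) * - g (b - (b - x))
      + (1 - lam) * (b - x) powr \<alpha> * f (b - (b - x)) + lam * (b - x) powr \<alpha> * f (b - 0)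
      - \<alpha> * (LINT t:{0..b - x}|lebesgue. t powr (\<alpha> - 1) * f (b - t))"
  proof (rule fractional_integral_by_parts[where h = "\<lambda>t. h (b - t)" and \<gamma> = "\<lambda>t. - g (b - t)"])
    show "continuous_on {0..b - x} (\<lambda>t. f (b - t))" "continuous_on {0..b - x} (\<lambda>t. - g (b - t))"
      using x by (auto intro!: continuous_intros continuous_on_compose2[OF assms(7)]
          continuous_on_compose2[OF contg])
    have "(\<lambda>t. h (b - t)) absolutely_integrable_on {t. b - t \<in> {a..b}}"
      using set_integrable_lebesgue_real_affine[OF h, of "-1" b] by simp
    then show "(\<lambda>t. h (b - t)) absolutely_integrable_on {0..b - x}"
      by (rule set_integrable_subset) (use x in auto)
    fix t assume "t \<in> {0<..<b - x}"
    then have t: "b - t \<in> {a<..<b}" using x by auto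
    have flip: "((\<lambda>t. b - t) has_real_derivative - 1) (at t)"
      by (auto intro!: derivative_eq_intros)
    show "((\<lambda>t. f (b - t)) has_real_derivative - g (b - t)) (at t)"
      using DERIV_chain2[OF fg'[OF t] flip] by simp
    show "((\<lambda>t. - g (b - t)) has_real_derivative h (b - t)) (at t)"
      using DERIV_minus[OF DERIV_chain2[OF gh[OF t] flip]] by simp
  qed (use x \<alpha> in auto)

  \<comment> \<open>Sum of the two halves and division by \<open>b - a\<close>\<close>
  define A where "A = (LINT t:{0..1}|lebesgue.
      t * ((\<alpha> + 1) * lam - t powr \<alpha>) * deriv (deriv f) (t * x + (1 - t) * a))"
  define B where "B = (LINT t:{0..1}|lebesgue.
      t * ((\<alpha> + 1) * lam - t powr \<alpha>) * deriv (deriv f) (t * x + (1 - t) * b))"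
  have "a + (x - a) * t = t * x + (1 - t) * a" "b - (b - x) * t = t * x + (1 - t) * b" for t
    by (simp_all add: algebra_simps)
  then have "(x - a) powr (\<alpha> + 2) / (\<alpha> + 1) * A + (b - x) powr (\<alpha> + 2) / (\<alpha> + 1) * B
      = (1 - lam) * ((x - a) powr \<alpha> + (b - x) powr \<alpha>) * f x
        + lam * ((x - a) powr \<alpha> * f a + (b - x) powr \<alpha> * f b)
        + (1 / (\<alpha> + 1) - lam) * ((b - x) powr (\<alpha> + 1) - (x - a) powr (\<alpha> + 1)) * g x
        - Gamma (\<alpha> + 1) * (RL_minus \<alpha> x f a + RL_plus \<alpha> x f b)"
    (is "_ = ?R")
    using left right unfolding RL A_def B_def h_def by (simp add: algebra_simps)
  moreover have "I_fun I f x lam \<alpha> a b = ?R / (b - a)"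
    by (simp only: I_fun_def deriv_x times_divide_eq_left times_divide_eq_right
        flip: diff_divide_distrib add_divide_distrib)
  ultimately have "I_fun I f x lam \<alpha> a b
      = ((x - a) powr (\<alpha> + 2) / (\<alpha> + 1) * A + (b - x) powr (\<alpha> + 2) / (\<alpha> + 1) * B) / (b - a)"
    by simp
  then show "I_fun I f x lam \<alpha> a b =
      (x - a) powr (\<alpha> + 2) / ((\<alpha> + 1) * (b - a)) * A
    + (b - x) powr (\<alpha> + 2) / ((\<alpha> + 1) * (b - a)) * B"
    by (simp add: add_divide_distrib)
qed

end
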